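(* Consider a potentially infinite set of null hypotheses $H_1,H_2,\dots$ for the distribution $P$ of an observation $X$, with associated $p$-values $p_1,p_2,\dots$ (based on $X$). Consider an ordering $\pi(1),\pi(2),\dots$ (potentially depending on $X$) and a set of critical values $\alpha_1,\alpha_2,\dots$ (potentially depending on $X$). Let $\lambda\in[0,1)$ be a parameter and assume that there exists a filtration $$\mathcal F_k=\sigma\bigl((\pi(i))_{1\le i\le k},(\mathbf 1\{p_{\pi(i)}\le\alpha_i\})_{1\le i\le k},(\mathbf 1\{p_{\pi(i)}>\lambda\})_{1\le i\le k}\bigr),\quad k\ge1,$$ such that for all $k\ge2$, $$\mathbf P(p_{\pi(k)}\le t\mid\mathcal F_{k-1},H_{\pi(k)}=0)\le t\quad\text{for all }t\in[0,1].$$ Then, for any $\delta\in(0,1)$, with probability at least $1-\delta$, it holds $$\forall k\ge1,\quad\sum_{i=1}^k(1-H_{\pi(i)})\mathbf 1\{p_{\pi(i)}\le\alpha_i\}\le\overline V_k,$$ for $$\overline V_k=\sum_{i=1}^k(1-H_{\pi(i)})\mathbf 1\{p_{\pi(i)}>\lambda\}\frac{\alpha_i}{1-\lambda}+\Delta\Bigl(\sum_{i=1}^k(1-H_{\pi(i)})\nu_i\Bigr),$$ where $\Delta(u)=2\sqrt{\varepsilon_u}\sqrt{u\vee1}+\frac12\varepsilon_u$, $\varepsilon_u=\log((1+\kappa)/\delta)+2\log(1+\log_2(u\vee1))$, $u>0$, $\kappa=\pi_\circ^2/6$ (with $\pi_\circ=3.14159\ldots$), and $\nu_i=\alpha_i\bigl(1+\min(\alpha_i,\lambda)/(1-\lambda)\bigr)$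 for $i\ge1$.
   Context: The symbol $H_i$ also denotes the status of the $i$-th null hypothesis: $H_i=0$ if it is true and $H_i=1$ if it is false. $u\vee1=\max(u,1)$.
   Formalization: Two hypotheses are added, without which the claim fails: each critical value α_k with k ≥ 2 is F_{k-1}-measurable (fails e.g. for uniform p-values with α_i = p_i, λ = 0), and all critical values α_i are nonnegative. *)

theory Defs
  imports "HOL-Probability.Probability" "HOL-Library.Extended_Nat"
begin

(* Indices 1, 2, ..., m of the hypotheses, where m = \<infinity> is allowed. *)
definition hyp_index :: "enat \<Rightarrow> nat set" where
  "hyp_index m = {i. 1 \<le> i \<and> enat i \<le> m}"

(* A null hypothesis is a set of candidate distributions of the observation;
   it is true (status 0) for the distribution P iff P belongs to it. *)
definition null_status :: "'x measure \<Rightarrow> (nat \<Rightarrow> 'x measure set) \<Rightarrow> nat \<Rightarrow> real" where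
  "null_status P H i = (if P \<in> H i then 0 else 1)"

(* Since the ordering is integer valued, the events {ord i = j} generate the sigma-algebra
   of ord i; an indicator and its event generate the same sigma-algebra. *)
definition pval_filtration ::
    "'a measure \<Rightarrow> (nat \<Rightarrow> 'a \<Rightarrow> real) \<Rightarrow> (nat \<Rightarrow> 'a \<Rightarrow> nat) \<Rightarrow> (nat \<Rightarrow> 'a \<Rightarrow> real) \<Rightarrow> real
      \<Rightarrow> nat \<Rightarrow> 'a measure" where
  "pval_filtration M p ord \<alpha> lam k = sigma (space M)
     ({{\<omega> \<in> space M. ord i \<omega> = j} | i j. i \<in> {1..k}}
      \<union> {{\<omega> \<in> space M. p (ord i \<omega>) \<omega> \<le> \<alpha> i \<omega>} | i. i \<in> {1..k}}
      \<union> {{\<omega> \<in> space M. p (ord i \<omega>) \<omega> > lam} | i. i \<in> {1..k}})"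

(* Conditional probability of A given the sigma-algebra F and the event B, i.e.
   P(A, B | F) / P(B | F).  Where P(B | F) = 0 the numerator vanishes almost surely as well,
   and the value is 0. If B belongs to F, this is P(A | F) almost surely on B. *)
definition cond_prob_given ::
    "'a measure \<Rightarrow> 'a measure \<Rightarrow> 'a set \<Rightarrow> 'a set \<Rightarrow> 'a \<Rightarrow> real" where
  "cond_prob_given M F B A \<omega> =
     real_cond_exp M F (indicator (A \<inter> B)) \<omega> / real_cond_exp M F (indicator B) \<omega>"

definition kappa :: real where
  "kappa = pi\<^sup>2 / 6"

definition eps :: "real \<Rightarrow> real \<Rightarrow> real" where
  "eps \<delta> u = ln ((1 + kappa) / \<delta>) + 2 * ln (1 + log 2 (max u 1))"

definition Delta :: "real \<Rightarrow> real \<Rightarrow> real" where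
  "Delta \<delta> u = 2 * sqrt (eps \<delta> u) * sqrt (max u 1) + eps \<delta> u / 2"

definition nu :: "real \<Rightarrow> real \<Rightarrow> real" where
  "nu lam a = a * (1 + min a lam / (1 - lam))"

definition Vbar ::
    "(nat \<Rightarrow> real) \<Rightarrow> (nat \<Rightarrow> 'a \<Rightarrow> real) \<Rightarrow> (nat \<Rightarrow> 'a \<Rightarrow> nat) \<Rightarrow> (nat \<Rightarrow> 'a \<Rightarrow> real) \<Rightarrow> real
      \<Rightarrow> real \<Rightarrow> nat \<Rightarrow> 'a \<Rightarrow> real" where
  "Vbar h p ord \<alpha> lam \<delta> k \<omega> =
     (\<Sum>i=1..k. (1 - h (ord i \<omega>)) * of_bool (p (ord i \<omega>) \<omega> > lam) * (\<alpha> i \<omega> / (1 - lam)))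
     + Delta \<delta> (\<Sum>i=1..k. (1 - h (ord i \<omega>)) * nu lam (\<alpha> i \<omega>))"

end

theory Submission
  imports Defs
begin

text \<open>
  Write \<open>D\<^sub>i = 1{p \<le> \<alpha>\<^sub>i} - 1{p > \<lambda>} \<alpha>\<^sub>i / (1 - \<lambda>)\<close> with \<open>p\<close> the \<open>i\<close>-th inspected p-value. Given the
  past, \<open>exp (\<theta> D\<^sub>i)\<close> is a nonincreasing step function of \<open>p\<close>, so on true nulls its conditional mean is at
  most the one for a uniform \<open>p\<close>; with \<open>exp y \<le> 1 + y + y\<^sup>2 / (2 - \<theta>)\<close> for \<open>y \<le> \<theta> < 2\<close> the latter
  is at most \<open>exp (g \<nu>\<^sub>i)\<close>, where \<open>g = \<theta>\<^sup>2 / (2 - \<theta>)\<close>. The products of \<open>exp (\<theta> D\<^sub>i - g \<nu>\<^sub>i)\<close> over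
  the true nulls among \<open>2, \<dots>, k\<close> thus form a nonnegative supermartingale, and Ville's inequality
  bounds the sum of the \<open>D\<^sub>i\<close> by the line \<open>x u / 2 + e / x + e / 2\<close> in the accumulated \<open>u\<close> of the
  \<open>\<nu>\<^sub>i\<close>, where \<open>\<theta> = 2 x / (2 + x)\<close>, outside an event of probability \<open>exp (- e)\<close>.

  One line is used for each dyadic block \<open>2\<^sup>j \<le> u < 2\<^sup>j\<^sup>+\<^sup>1\<close>; it stays below
  \<open>3/2 sqrt (e u) + e / 2\<close> there, while \<open>\<Delta>(u)\<close> has the constant \<open>2\<close>. The difference is at least 1,
  which absorbs the first step, about which nothing is assumed. For \<open>u < 2\<close> this needs the
  block \<open>j = 0\<close> to receive twice its share of \<open>\<delta>\<close>, which is what the summand 1 in \<open>1 + \<kappa>\<close> pays for.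
\<close>

section \<open>Exponential moments of the excess under a uniform p-value\<close>

lemma exp_le_pade:
  fixes y :: real
  assumes "0 \<le> y" "y < 2"
  shows "exp y \<le> (2 + y) / (2 - y)"
proof -
  let ?f = "\<lambda>y::real. (2 + y) * exp (- y) - (2 - y)"
  have "?f 0 \<le> ?f y"
  proof (rule DERIV_nonneg_imp_nondecreasing[OF assms(1)])
    fix z :: real assume "0 \<le> z" "z \<le> y"
    have "(1 + z) * exp (- z) \<le> exp z * exp (- z)"
      by (intro mult_right_mono exp_ge_add_one_self) simp
    moreover have "(?f has_real_derivative (1 - (1 + z) * exp (- z))) (at z)"
      by (auto intro!: derivative_eq_intros simp: algebra_simps)
    ultimately show "\<exists>d. (?f has_real_derivative d) (at z) \<and> d \<ge> 0"
      by (auto simp flip: exp_add)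
  qed
  then show ?thesis using assms by (simp add: exp_minus field_simps)
qed

lemma exp_le_quadratic_nonpos:
  fixes y :: real
  assumes "y \<le> 0"
  shows "exp y \<le> 1 + y + y\<^sup>2 / 2"
proof -
  define z where "z = - y"
  have "(1 + z + z\<^sup>2 / 2) * (1 - z + z\<^sup>2 / 2) = 1 + (z\<^sup>2)\<^sup>2 / 4"
    by (simp add: power2_eq_square algebra_simps)
  then have "1 \<le> (1 + z + z\<^sup>2 / 2) * (1 - z + z\<^sup>2 / 2)" by simp
  also have "\<dots> \<le> exp z * (1 - z + z\<^sup>2 / 2)"
  proof (rule mult_right_mono[OF exp_lower_Taylor_quadratic])
    show "0 \<le> 1 - z + z\<^sup>2 / 2"
      using zero_le_power2[of "1 - z"] by (simp add: power2_eq_square algebra_simps)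
  qed (use assms in \<open>simp add: z_def\<close>)
  finally show ?thesis by (simp add: z_def exp_minus field_simps)
qed

lemma exp_le_quadratic:
  fixes y \<theta> :: real
  assumes "y \<le> \<theta>" "0 \<le> \<theta>" "\<theta> < 2"
  shows "exp y \<le> 1 + y + y\<^sup>2 / (2 - \<theta>)"
proof (cases "0 \<le> y")
  case True
  then have "exp y \<le> (2 + y) / (2 - y)" using assms by (intro exp_le_pade) auto
  also have "\<dots> = 1 + y + y\<^sup>2 / (2 - y)"
    using assms by (simp add: field_simps power2_eq_square)
  also have "\<dots> \<le> 1 + y + y\<^sup>2 / (2 - \<theta>)"
    using assms by (intro add_left_mono divide_left_mono) auto
  finally show ?thesis .
next
  case False
  then have "exp y \<le> 1 + y + y\<^sup>2 / 2" by (intro exp_le_quadratic_nonpos) simp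
  also have "\<dots> \<le> 1 + y + y\<^sup>2 / (2 - \<theta>)"
    using assms by (intro add_left_mono divide_left_mono) auto
  finally show ?thesis .
qed

definition excess :: "real \<Rightarrow> real \<Rightarrow> real \<Rightarrow> real" where
  "excess lam a q = of_bool (q \<le> a) - of_bool (q > lam) * (a / (1 - lam))"

text \<open>The value of \<open>excess lam a q\<close> for \<open>min a lam < q \<le> max a lam\<close>.\<close>
definition middle_excess :: "real \<Rightarrow> real \<Rightarrow> real" where
  "middle_excess lam a = (if a \<le> lam then 0 else 1 - a / (1 - lam))"

lemma middle_excess_bounds:
  assumes "0 \<le> a" "lam < 1"
  shows "- (a / (1 - lam)) \<le> middle_excess lam a" "middle_excess lam a \<le> 1"
  using assms by (auto simp: middle_excess_def)

definition exp_excess_base :: "real \<Rightarrow> real \<Rightarrow> real \<Rightarrow> real" where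
  "exp_excess_base \<theta> lam a = exp (- \<theta> * (a / (1 - lam)))"

definition exp_excess_step_max :: "real \<Rightarrow> real \<Rightarrow> real \<Rightarrow> real" where
  "exp_excess_step_max \<theta> lam a = exp (\<theta> * middle_excess lam a) - exp (- \<theta> * (a / (1 - lam)))"

definition exp_excess_step_min :: "real \<Rightarrow> real \<Rightarrow> real \<Rightarrow> real" where
  "exp_excess_step_min \<theta> lam a = exp \<theta> - exp (\<theta> * middle_excess lam a)"

lemmas exp_excess_step_defs = exp_excess_base_def exp_excess_step_max_def exp_excess_step_min_def

lemma exp_excess_eq:
  "exp (\<theta> * excess lam a q) = exp_excess_base \<theta> lam a
     + exp_excess_step_max \<theta> lam a * of_bool (q \<le> max a lam)
     + exp_excess_step_min \<theta> lam a * of_bool (q \<le> min a lam)"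
  by (auto simp: exp_excess_step_defs excess_def middle_excess_def)

lemma exp_excess_step_nonneg:
  assumes "0 \<le> \<theta>" "0 \<le> a" "lam < 1"
  shows "0 \<le> exp_excess_base \<theta> lam a" "0 \<le> exp_excess_step_max \<theta> lam a"
    "0 \<le> exp_excess_step_min \<theta> lam a"
  using mult_left_mono[OF middle_excess_bounds(1)[OF assms(2,3)] assms(1)]
    mult_left_mono[OF middle_excess_bounds(2)[OF assms(2,3)] assms(1)]
  by (auto simp: exp_excess_step_defs)

lemma borel_measurable_exp_excess_step [measurable]:
  "exp_excess_base \<theta> lam \<in> borel_measurable borel"
  "exp_excess_step_max \<theta> lam \<in> borel_measurable borel"
  "exp_excess_step_min \<theta> lam \<in> borel_measurable borel"
  unfolding exp_excess_step_defs middle_excess_def by measurable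

lemma excess_le_1:
  assumes "0 \<le> a" "lam < 1"
  shows "excess lam a q \<le> 1"
proof -
  have "0 \<le> a / (1 - lam)" using assms by simp
  then show ?thesis by (simp add: excess_def)
qed

lemma excess_le_excess_min_1:
  assumes "q \<le> 1" "lam < 1"
  shows "excess lam a q \<le> excess lam (min a 1) q"
  using assms by (auto simp: excess_def divide_right_mono)

lemma nu_nonneg: "0 \<le> a \<Longrightarrow> 0 \<le> lam \<Longrightarrow> lam < 1 \<Longrightarrow> 0 \<le> nu lam a"
  by (simp add: nu_def)

lemma nu_mono:
  assumes "0 \<le> a" "a \<le> b" "0 \<le> lam" "lam < 1"
  shows "nu lam a \<le> nu lam b"
  unfolding nu_def using assms by (intro mult_mono add_left_mono divide_right_mono) auto

lemma borel_measurable_nu [measurable]: "nu lam \<in> borel_measurable borel"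
  unfolding nu_def by measurable

lemma borel_measurable_excess [measurable (raw)]:
  assumes [measurable]: "a \<in> borel_measurable M" "q \<in> borel_measurable M"
  shows "(\<lambda>\<omega>. excess lam (a \<omega>) (q \<omega>)) \<in> borel_measurable M"
  unfolding excess_def by measurable

lemma uniform_mean_excess_eq_0:
  assumes "lam < 1"
  shows "min a lam + (max a lam - min a lam) * middle_excess lam a
    - (1 - max a lam) * (a / (1 - lam)) = 0"
  using assms by (cases "a \<le> lam")
    (simp_all add: middle_excess_def max_def min_def divide_simps, algebra+)

lemma uniform_second_moment_excess_le:
  assumes "0 \<le> a" "0 \<le> lam" "lam < 1"
  shows "min a lam + (max a lam - min a lam) * (middle_excess lam a)\<^sup>2
    + (1 - max a lam) * (a / (1 - lam))\<^sup>2 \<le> nu lam a"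
proof -
  define c where "c = a / (1 - lam)"
  have c: "0 \<le> c" "a = c * (1 - lam)" using assms by (auto simp: c_def)
  show ?thesis
  proof (cases "a \<le> lam")
    case True
    have "a + (1 - lam) * c\<^sup>2 = a * (1 + c)"
      unfolding c(2) by (simp add: power2_eq_square algebra_simps)
    then show ?thesis using True by (simp add: middle_excess_def nu_def c_def)
  next
    case False
    have "lam + (a - lam) * (1 - c)\<^sup>2 + (1 - a) * c\<^sup>2 = c * (1 - (a - lam))"
      unfolding c(2) by (simp add: power2_eq_square algebra_simps)
    also have "\<dots> \<le> c * 1" using False c(1) by (intro mult_left_mono) auto
    also have "c * 1 = nu lam a" using False assms by (simp add: nu_def c_def field_simps)
    finally show ?thesis using False by (simp add: middle_excess_def c_def)
  qed
qed

definition sub_gamma :: "real \<Rightarrow> real" where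
  "sub_gamma \<theta> = \<theta>\<^sup>2 / (2 - \<theta>)"

lemma uniform_mgf_excess_le:
  assumes \<theta>: "0 \<le> \<theta>" "\<theta> < 2" and a: "0 \<le> a" "a \<le> 1" and lam: "0 \<le> lam" "lam < 1"
  shows "exp_excess_base \<theta> lam a + exp_excess_step_max \<theta> lam a * max a lam
      + exp_excess_step_min \<theta> lam a * min a lam \<le> exp (sub_gamma \<theta> * nu lam a)" (is "?mgf \<le> _")
proof -
  define g where "g = sub_gamma \<theta>"
  define c where "c = a / (1 - lam)"
  define d where "d = middle_excess lam a"
  have exp_le: "exp (\<theta> * x) \<le> 1 + \<theta> * x + g * x\<^sup>2" if "x \<le> 1" for x
    using exp_le_quadratic[of "\<theta> * x" \<theta>] that \<theta>
    by (simp add: g_def sub_gamma_def power_mult_distrib mult_left_le)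
  have "?mgf = min a lam * exp \<theta> + (max a lam - min a lam) * exp (\<theta> * d)
      + (1 - max a lam) * exp (\<theta> * (- c))"
    by (simp add: exp_excess_step_defs c_def d_def algebra_simps)
  also have "\<dots> \<le> min a lam * (1 + \<theta> * 1 + g * 1\<^sup>2) + (max a lam - min a lam) * (1 + \<theta> * d + g * d\<^sup>2)
      + (1 - max a lam) * (1 + \<theta> * (- c) + g * (- c)\<^sup>2)"
  proof -
    have "0 \<le> c" "d \<le> 1" using a lam middle_excess_bounds(2)[of a lam] by (auto simp: c_def d_def)
    then show ?thesis
      unfolding c_def[symmetric] d_def[symmetric]
      using exp_le[of 1] exp_le[of d] exp_le[of "- c"] a lam
      by (intro add_mono mult_left_mono) auto
  qed
  also have "\<dots> = 1 + \<theta> * (min a lam + (max a lam - min a lam) * d - (1 - max a lam) * c)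
      + g * (min a lam + (max a lam - min a lam) * d\<^sup>2 + (1 - max a lam) * c\<^sup>2)"
    by (simp add: algebra_simps)
  also have "\<dots> \<le> 1 + \<theta> * 0 + g * nu lam a"
    unfolding c_def d_def uniform_mean_excess_eq_0[OF lam(2)]
    using \<theta> by (intro add_left_mono mult_left_mono uniform_second_moment_excess_le a lam)
      (simp add: g_def sub_gamma_def)
  also have "\<dots> \<le> exp (g * nu lam a)" by simp
  finally show ?thesis by (simp add: g_def)
qed

section \<open>Conditionally superuniform p-values\<close>

lemma (in finite_measure_subalgebra) nn_cond_exp_indicator_eq:
  assumes [measurable]: "S \<in> sets M"
  shows "AE \<omega> in M. nn_cond_exp M F (indicator S) \<omega> = ennreal (real_cond_exp M F (indicator S) \<omega>)"
proof -
  have le: "AE \<omega> in M. nn_cond_exp M F (indicator S) \<omega> \<le> nn_cond_exp M F (\<lambda>_. 1) \<omega>"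
    by (rule nn_cond_exp_mono) (auto simp: indicator_def)
  have const: "AE \<omega> in M. nn_cond_exp M F (\<lambda>_. 1) \<omega> = 1" "AE \<omega> in M. nn_cond_exp M F (\<lambda>_. 0) \<omega> = 0"
    using nn_cond_exp_F_meas[of "\<lambda>_. 1"] nn_cond_exp_F_meas[of "\<lambda>_. 0"] by (auto elim: AE_mp)
  have "(\<lambda>\<omega>. ennreal (indicator S \<omega>)) = indicator S" "(\<lambda>\<omega>. ennreal (- indicator S \<omega>)) = (\<lambda>_. 0)"
    by (auto simp: fun_eq_iff indicator_def ennreal_neg)
  then have eq: "real_cond_exp M F (indicator S)
      = (\<lambda>\<omega>. enn2real (nn_cond_exp M F (indicator S) \<omega>) - enn2real (nn_cond_exp M F (\<lambda>_. 0) \<omega>))"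
    by (simp add: real_cond_exp_def)
  show ?thesis
    unfolding eq using le const
  proof eventually_elim
    case (elim \<omega>)
    then have "nn_cond_exp M F (indicator S) \<omega> < \<top>" by (auto intro: le_less_trans)
    then show ?case using elim by simp
  qed
qed

lemma (in finite_measure_subalgebra) set_nn_integral_cond_prob_given_le:
  fixes G :: "'a \<Rightarrow> ennreal"
  assumes [measurable]: "A \<in> sets M" "B \<in> sets M" "G \<in> borel_measurable F"
    and t: "0 \<le> t" and le: "AE \<omega> in M. cond_prob_given M F B A \<omega> \<le> t"
  shows "(\<integral>\<^sup>+\<omega>\<in>A \<inter> B. G \<omega> \<partial>M) \<le> (\<integral>\<^sup>+\<omega>\<in>B. G \<omega> * ennreal t \<partial>M)"
proof -
  let ?P = "\<lambda>S. real_cond_exp M F (indicator S)"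
  have [measurable]: "G \<in> borel_measurable M"
    by (rule measurable_from_subalg[OF subalg]) measurable
  have "AE \<omega> in M. 0 \<le> ?P B \<omega>" "AE \<omega> in M. ?P (A \<inter> B) \<omega> \<le> ?P B \<omega>"
    by (auto intro!: real_cond_exp_pos real_cond_exp_mono integrable_real_indicator
        simp: indicator_def emeasure_eq_measure)
  then have "AE \<omega> in M. nn_cond_exp M F (indicator (A \<inter> B)) \<omega>
      \<le> ennreal t * nn_cond_exp M F (indicator B) \<omega>"
    using le nn_cond_exp_indicator_eq[of B, simplified] nn_cond_exp_indicator_eq[of "A \<inter> B", simplified]
  proof eventually_elim
    case (elim \<omega>)
    then have "?P (A \<inter> B) \<omega> \<le> t * ?P B \<omega>"
      by (cases "?P B \<omega> = 0") (auto simp: cond_prob_given_def field_simps)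
    then show ?case using elim t by (simp add: ennreal_mult[symmetric] ennreal_leI)
  qed
  then have "(\<integral>\<^sup>+\<omega>. G \<omega> * nn_cond_exp M F (indicator (A \<inter> B)) \<omega> \<partial>M)
    \<le> (\<integral>\<^sup>+\<omega>. (G \<omega> * ennreal t) * nn_cond_exp M F (indicator B) \<omega> \<partial>M)"
    by (intro nn_integral_mono_AE)
      (auto simp: mult.assoc elim!: eventually_mono intro: mult_left_mono)
  then show ?thesis by (simp add: nn_cond_exp_intg)
qed

lemma nn_integral_countable_image:
  fixes f :: "'b::{second_countable_topology, t2_space} \<Rightarrow> 'a \<Rightarrow> ennreal"
  assumes countable: "countable (b ` space M)"
    and [measurable]: "b \<in> borel_measurable M" "\<And>t. f t \<in> borel_measurable M"
  shows "(\<integral>\<^sup>+\<omega>. f (b \<omega>) \<omega> \<partial>M)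
    = (\<integral>\<^sup>+t. (\<integral>\<^sup>+\<omega>. f t \<omega> * of_bool (b \<omega> = t) \<partial>M) \<partial>count_space (b ` space M))"
proof -
  let ?T = "count_space (b ` space M)"
  have "(\<integral>\<^sup>+t. f t \<omega> * of_bool (b \<omega> = t) \<partial>?T) = f (b \<omega>) \<omega>" if "\<omega> \<in> space M" for \<omega>
  proof -
    have "(\<integral>\<^sup>+t. f t \<omega> * of_bool (b \<omega> = t) \<partial>?T) = (\<integral>\<^sup>+t\<in>{b \<omega>}. f t \<omega> \<partial>?T)"
      by (intro nn_integral_cong) (auto simp: indicator_def)
    then show ?thesis using that by simp
  qed
  then have "(\<integral>\<^sup>+\<omega>. f (b \<omega>) \<omega> \<partial>M) = (\<integral>\<^sup>+\<omega>. (\<integral>\<^sup>+t. f t \<omega> * of_bool (b \<omega> = t) \<partial>?T) \<partial>M)"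
    by (intro nn_integral_cong) simp
  also have "\<dots> = (\<integral>\<^sup>+t. (\<integral>\<^sup>+\<omega>. f t \<omega> * of_bool (b \<omega> = t) \<partial>M) \<partial>?T)"
    by (intro nn_integral_count_space_nn_integral countable) measurable
  finally show ?thesis .
qed

definition geometric_ceiling :: "real \<Rightarrow> real \<Rightarrow> real" where
  "geometric_ceiling s x = (if x = 0 then 0 else s powr \<lfloor>log s x\<rfloor>)"

lemma geometric_ceiling_bounds:
  assumes "0 < s" "s < 1" "0 \<le> x"
  shows "x \<le> geometric_ceiling s x" "s * geometric_ceiling s x \<le> x"
proof -
  have "s powr log s x \<le> s powr \<lfloor>log s x\<rfloor>" "s powr (\<lfloor>log s x\<rfloor> + 1) \<le> s powr log s x"
    using assms by (auto intro!: powr_mono' simp: less_imp_le)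
  then show "x \<le> geometric_ceiling s x" "s * geometric_ceiling s x \<le> x"
    using assms by (auto simp: geometric_ceiling_def powr_add mult.commute)
qed

lemma countable_range_geometric_ceiling: "countable (range (geometric_ceiling s))"
proof (rule countable_subset)
  show "range (geometric_ceiling s) \<subseteq> insert 0 (range (\<lambda>z::int. s powr z))"
    by (auto simp: geometric_ceiling_def)
qed auto

lemma borel_measurable_geometric_ceiling [measurable]: "geometric_ceiling s \<in> borel_measurable borel"
  unfolding geometric_ceiling_def by measurable

locale cond_superuniform = finite_measure_subalgebra M F for M :: "'a measure" and F +
  fixes B :: "'a set" and q :: "'a \<Rightarrow> real"
  assumes null_event [measurable]: "B \<in> sets M"
    and pvalue [measurable]: "q \<in> borel_measurable M"
    and superuniform: "t \<in> {0..1} \<Longrightarrow>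
      AE \<omega> in M. cond_prob_given M F B {\<omega> \<in> space M. q \<omega> \<le> t} \<omega> \<le> t"
begin

lemma borel_measurable_subalg [measurable (raw)]: "f \<in> borel_measurable F \<Longrightarrow> f \<in> borel_measurable M"
  by (rule measurable_from_subalg[OF subalg])

lemma set_nn_integral_pvalue_le_const:
  fixes G :: "'a \<Rightarrow> ennreal"
  assumes [measurable]: "G \<in> borel_measurable F" and t: "0 \<le> t"
  shows "(\<integral>\<^sup>+\<omega>\<in>B. G \<omega> * of_bool (q \<omega> \<le> t) \<partial>M) \<le> (\<integral>\<^sup>+\<omega>\<in>B. G \<omega> * ennreal t \<partial>M)"
proof (cases "t \<le> 1")
  case True
  have "(\<integral>\<^sup>+\<omega>\<in>B. G \<omega> * of_bool (q \<omega> \<le> t) \<partial>M) = (\<integral>\<^sup>+\<omega>\<in>{\<omega> \<in> space M. q \<omega> \<le> t} \<inter> B. G \<omega> \<partial>M)"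
    by (intro nn_integral_cong) (auto simp: indicator_def)
  also have "\<dots> \<le> (\<integral>\<^sup>+\<omega>\<in>B. G \<omega> * ennreal t \<partial>M)"
    using t True by (intro set_nn_integral_cond_prob_given_le superuniform) auto
  finally show ?thesis .
next
  case False
  then have "of_bool (q \<omega> \<le> t) \<le> ennreal t" for \<omega> by (auto simp: ennreal_ge_1)
  then show ?thesis by (intro nn_integral_mono mult_right_mono mult_left_mono) auto
qed

lemma set_nn_integral_pvalue_le_countable:
  fixes G :: "'a \<Rightarrow> ennreal" and b :: "'a \<Rightarrow> real"
  assumes [measurable]: "G \<in> borel_measurable F" "b \<in> borel_measurable F"
    and b: "\<And>\<omega>. \<omega> \<in> space M \<Longrightarrow> 0 \<le> b \<omega>" and countable: "countable (b ` space M)"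
  shows "(\<integral>\<^sup>+\<omega>\<in>B. G \<omega> * of_bool (q \<omega> \<le> b \<omega>) \<partial>M) \<le> (\<integral>\<^sup>+\<omega>\<in>B. G \<omega> * ennreal (b \<omega>) \<partial>M)"
proof -
  let ?T = "count_space (b ` space M)"
  have "(\<integral>\<^sup>+\<omega>\<in>B. G \<omega> * of_bool (q \<omega> \<le> b \<omega>) \<partial>M)
      = (\<integral>\<^sup>+t. (\<integral>\<^sup>+\<omega>\<in>B. G \<omega> * of_bool (b \<omega> = t) * of_bool (q \<omega> \<le> t) \<partial>M) \<partial>?T)"
    by (subst nn_integral_countable_image[OF countable]) (simp_all add: ac_simps)
  also have "\<dots> \<le> (\<integral>\<^sup>+t. (\<integral>\<^sup>+\<omega>\<in>B. G \<omega> * of_bool (b \<omega> = t) * ennreal t \<partial>M) \<partial>?T)"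
    using b by (intro nn_integral_mono[of ?T] set_nn_integral_pvalue_le_const) auto
  also have "\<dots> = (\<integral>\<^sup>+\<omega>\<in>B. G \<omega> * ennreal (b \<omega>) \<partial>M)"
    by (subst nn_integral_countable_image[OF countable]) (simp_all add: ac_simps)
  finally show ?thesis .
qed

lemma set_nn_integral_pvalue_le:
  fixes G :: "'a \<Rightarrow> ennreal" and a :: "'a \<Rightarrow> real"
  assumes [measurable]: "G \<in> borel_measurable F" "a \<in> borel_measurable F"
    and a: "\<And>\<omega>. \<omega> \<in> space M \<Longrightarrow> 0 \<le> a \<omega>"
  shows "(\<integral>\<^sup>+\<omega>\<in>B. G \<omega> * of_bool (q \<omega> \<le> a \<omega>) \<partial>M) \<le> (\<integral>\<^sup>+\<omega>\<in>B. G \<omega> * ennreal (a \<omega>) \<partial>M)"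
proof (rule ennreal_approx_unit)
  \<comment> \<open>Rounding the level up to a geometric grid of ratio \<open>s\<close> costs a factor \<open>1 / s\<close>.\<close>
  fix r :: ennreal assume "0 < r" "r < 1"
  then obtain s where s: "r = ennreal s" "0 < s" "s < 1"
    by (cases r) auto
  define b where "b \<omega> = geometric_ceiling s (a \<omega>)" for \<omega>
  have [measurable]: "b \<in> borel_measurable F" unfolding b_def by measurable
  have b: "a \<omega> \<le> b \<omega>" "s * b \<omega> \<le> a \<omega>" if "\<omega> \<in> space M" for \<omega>
    using geometric_ceiling_bounds[OF s(2,3) a[OF that]] by (simp_all add: b_def)
  have "r * (\<integral>\<^sup>+\<omega>\<in>B. G \<omega> * of_bool (q \<omega> \<le> a \<omega>) \<partial>M) \<le> r * (\<integral>\<^sup>+\<omega>\<in>B. G \<omega> * of_bool (q \<omega> \<le> b \<omega>) \<partial>M)"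
    using b(1) by (intro mult_left_mono nn_integral_mono mult_right_mono) (auto intro: order_trans)
  also have "\<dots> \<le> r * (\<integral>\<^sup>+\<omega>\<in>B. G \<omega> * ennreal (b \<omega>) \<partial>M)"
  proof (intro mult_left_mono set_nn_integral_pvalue_le_countable)
    show "countable (b ` space M)"
      by (rule countable_subset[OF _ countable_range_geometric_ceiling[of s]]) (auto simp: b_def)
    show "0 \<le> b \<omega>" if "\<omega> \<in> space M" for \<omega> using order_trans[OF a b(1)] that by blast
  qed auto
  also have "\<dots> = (\<integral>\<^sup>+\<omega>\<in>B. G \<omega> * (r * ennreal (b \<omega>)) \<partial>M)"
    by (subst nn_integral_cmult[symmetric]) (auto simp: ac_simps)
  also have "\<dots> \<le> (\<integral>\<^sup>+\<omega>\<in>B. G \<omega> * ennreal (a \<omega>) \<partial>M)"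
    using s b(2) by (intro nn_integral_mono mult_right_mono mult_left_mono)
      (auto simp: ennreal_mult'[symmetric] intro!: ennreal_leI)
  finally show "r * (\<integral>\<^sup>+\<omega>\<in>B. G \<omega> * of_bool (q \<omega> \<le> a \<omega>) \<partial>M) \<le> (\<integral>\<^sup>+\<omega>\<in>B. G \<omega> * ennreal (a \<omega>) \<partial>M)" .
qed

lemma set_nn_integral_two_levels_le:
  fixes G0 G1 G2 :: "'a \<Rightarrow> ennreal" and a b :: "'a \<Rightarrow> real"
  assumes [measurable]: "G0 \<in> borel_measurable F" "G1 \<in> borel_measurable F" "G2 \<in> borel_measurable F"
      "a \<in> borel_measurable F" "b \<in> borel_measurable F"
    and nonneg: "\<And>\<omega>. \<omega> \<in> space M \<Longrightarrow> 0 \<le> a \<omega>" "\<And>\<omega>. \<omega> \<in> space M \<Longrightarrow> 0 \<le> b \<omega>"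
  shows "(\<integral>\<^sup>+\<omega>\<in>B. G0 \<omega> + G1 \<omega> * of_bool (q \<omega> \<le> a \<omega>) + G2 \<omega> * of_bool (q \<omega> \<le> b \<omega>) \<partial>M)
    \<le> (\<integral>\<^sup>+\<omega>\<in>B. G0 \<omega> + G1 \<omega> * ennreal (a \<omega>) + G2 \<omega> * ennreal (b \<omega>) \<partial>M)"
proof -
  have add: "(\<integral>\<^sup>+\<omega>\<in>B. G0 \<omega> + f \<omega> + g \<omega> \<partial>M)
      = (\<integral>\<^sup>+\<omega>\<in>B. G0 \<omega> \<partial>M) + (\<integral>\<^sup>+\<omega>\<in>B. f \<omega> \<partial>M) + (\<integral>\<^sup>+\<omega>\<in>B. g \<omega> \<partial>M)"
    if [measurable]: "f \<in> borel_measurable M" "g \<in> borel_measurable M" for f g :: "'a \<Rightarrow> ennreal"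
    by (simp add: distrib_right nn_integral_add)
  show ?thesis
    by (subst (1 2) add) (auto intro!: add_mono set_nn_integral_pvalue_le nonneg)
qed

lemma set_nn_integral_exp_excess_le:
  fixes G :: "'a \<Rightarrow> ennreal" and a :: "'a \<Rightarrow> real"
  assumes [measurable]: "G \<in> borel_measurable F" "a \<in> borel_measurable F"
    and a: "\<And>\<omega>. \<omega> \<in> space M \<Longrightarrow> a \<omega> \<in> {0..1}"
    and \<theta>: "0 \<le> \<theta>" "\<theta> < 2" and lam: "0 \<le> lam" "lam < 1"
  shows "(\<integral>\<^sup>+\<omega>\<in>B. G \<omega> * ennreal (exp (\<theta> * excess lam (a \<omega>) (q \<omega>))) \<partial>M)
    \<le> (\<integral>\<^sup>+\<omega>\<in>B. G \<omega> * ennreal (exp (sub_gamma \<theta> * nu lam (a \<omega>))) \<partial>M)"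
proof -
  let ?base = "\<lambda>\<omega>. exp_excess_base \<theta> lam (a \<omega>)"
  let ?smax = "\<lambda>\<omega>. exp_excess_step_max \<theta> lam (a \<omega>)"
  let ?smin = "\<lambda>\<omega>. exp_excess_step_min \<theta> lam (a \<omega>)"
  have nonneg: "0 \<le> ?base \<omega>" "0 \<le> ?smax \<omega>" "0 \<le> ?smin \<omega>" if "\<omega> \<in> space M" for \<omega>
    using exp_excess_step_nonneg[OF \<theta>(1) _ lam(2)] a[OF that] by auto
  have "(\<integral>\<^sup>+\<omega>\<in>B. G \<omega> * ennreal (exp (\<theta> * excess lam (a \<omega>) (q \<omega>))) \<partial>M)
      = (\<integral>\<^sup>+\<omega>\<in>B. G \<omega> * ennreal (?base \<omega>) + G \<omega> * ennreal (?smax \<omega>) * of_bool (q \<omega> \<le> max (a \<omega>) lam)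
          + G \<omega> * ennreal (?smin \<omega>) * of_bool (q \<omega> \<le> min (a \<omega>) lam) \<partial>M)"
  proof (intro nn_integral_cong arg_cong2[where f = "(*)"] refl)
    fix \<omega> assume "\<omega> \<in> space M"
    then show "G \<omega> * ennreal (exp (\<theta> * excess lam (a \<omega>) (q \<omega>))) = G \<omega> * ennreal (?base \<omega>)
        + G \<omega> * ennreal (?smax \<omega>) * of_bool (q \<omega> \<le> max (a \<omega>) lam)
        + G \<omega> * ennreal (?smin \<omega>) * of_bool (q \<omega> \<le> min (a \<omega>) lam)"
      using nonneg by (simp add: exp_excess_eq distrib_left of_bool_def)
  qed
  also have "\<dots> \<le> (\<integral>\<^sup>+\<omega>\<in>B. G \<omega> * ennreal (?base \<omega>) + G \<omega> * ennreal (?smax \<omega>) * ennreal (max (a \<omega>) lam)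
      + G \<omega> * ennreal (?smin \<omega>) * ennreal (min (a \<omega>) lam) \<partial>M)"
    using a lam by (intro set_nn_integral_two_levels_le) (auto simp: le_max_iff_disj)
  also have "\<dots> \<le> (\<integral>\<^sup>+\<omega>\<in>B. G \<omega> * ennreal (exp (sub_gamma \<theta> * nu lam (a \<omega>))) \<partial>M)"
  proof (intro nn_integral_mono mult_right_mono)
    fix \<omega> assume \<omega>: "\<omega> \<in> space M"
    have "G \<omega> * ennreal (?base \<omega>) + G \<omega> * ennreal (?smax \<omega>) * ennreal (max (a \<omega>) lam)
          + G \<omega> * ennreal (?smin \<omega>) * ennreal (min (a \<omega>) lam)
        = G \<omega> * ennreal (?base \<omega> + ?smax \<omega> * max (a \<omega>) lam + ?smin \<omega> * min (a \<omega>) lam)"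
      using nonneg[OF \<omega>] a[OF \<omega>] lam
      by (simp add: ennreal_mult le_max_iff_disj distrib_left mult.assoc)
    also have "\<dots> \<le> G \<omega> * ennreal (exp (sub_gamma \<theta> * nu lam (a \<omega>)))"
      using a[OF \<omega>] by (intro mult_left_mono ennreal_leI uniform_mgf_excess_le \<theta> lam) auto
    finally show "G \<omega> * ennreal (?base \<omega>) + G \<omega> * ennreal (?smax \<omega>) * ennreal (max (a \<omega>) lam)
        + G \<omega> * ennreal (?smin \<omega>) * ennreal (min (a \<omega>) lam)
      \<le> G \<omega> * ennreal (exp (sub_gamma \<theta> * nu lam (a \<omega>)))" .
  qed simp
  finally show ?thesis .
qed

lemma set_nn_integral_exp_compensated_excess_le:
  fixes G :: "'a \<Rightarrow> ennreal" and a :: "'a \<Rightarrow> real"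
  assumes [measurable]: "G \<in> borel_measurable F" "a \<in> borel_measurable F"
    and a: "\<And>\<omega>. \<omega> \<in> space M \<Longrightarrow> 0 \<le> a \<omega>" and q: "\<And>\<omega>. \<omega> \<in> space M \<Longrightarrow> q \<omega> \<le> 1"
    and \<theta>: "0 \<le> \<theta>" "\<theta> < 2" and lam: "0 \<le> lam" "lam < 1"
  shows "(\<integral>\<^sup>+\<omega>\<in>B. G \<omega> * ennreal (exp (\<theta> * excess lam (a \<omega>) (q \<omega>) - sub_gamma \<theta> * nu lam (a \<omega>))) \<partial>M)
    \<le> (\<integral>\<^sup>+\<omega>\<in>B. G \<omega> \<partial>M)"
proof -
  \<comment> \<open>Since \<open>q \<le> 1\<close>, clipping the level at 1 only increases the exponent.\<close>
  define b where "b \<omega> = min (a \<omega>) 1" for \<omega>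
  define H where "H \<omega> = G \<omega> * ennreal (exp (- (sub_gamma \<theta> * nu lam (b \<omega>))))" for \<omega>
  have [measurable]: "b \<in> borel_measurable F" unfolding b_def by measurable
  have [measurable]: "H \<in> borel_measurable F" unfolding H_def by measurable
  have "(\<integral>\<^sup>+\<omega>\<in>B. G \<omega> * ennreal (exp (\<theta> * excess lam (a \<omega>) (q \<omega>) - sub_gamma \<theta> * nu lam (a \<omega>))) \<partial>M)
      \<le> (\<integral>\<^sup>+\<omega>\<in>B. H \<omega> * ennreal (exp (\<theta> * excess lam (b \<omega>) (q \<omega>))) \<partial>M)"
  proof (intro nn_integral_mono mult_right_mono)
    fix \<omega> assume \<omega>: "\<omega> \<in> space M"
    have "\<theta> * excess lam (a \<omega>) (q \<omega>) - sub_gamma \<theta> * nu lam (a \<omega>)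
        \<le> \<theta> * excess lam (b \<omega>) (q \<omega>) - sub_gamma \<theta> * nu lam (b \<omega>)"
      unfolding b_def using a[OF \<omega>] q[OF \<omega>] \<theta> lam
      by (intro diff_mono mult_left_mono excess_le_excess_min_1 nu_mono) (auto simp: sub_gamma_def)
    also have "\<dots> = - (sub_gamma \<theta> * nu lam (b \<omega>)) + \<theta> * excess lam (b \<omega>) (q \<omega>)" by simp
    finally have "ennreal (exp (\<theta> * excess lam (a \<omega>) (q \<omega>) - sub_gamma \<theta> * nu lam (a \<omega>)))
        \<le> ennreal (exp (- (sub_gamma \<theta> * nu lam (b \<omega>))) * exp (\<theta> * excess lam (b \<omega>) (q \<omega>)))"
      unfolding exp_add[symmetric] by (intro ennreal_leI) simp
    then show "G \<omega> * ennreal (exp (\<theta> * excess lam (a \<omega>) (q \<omega>) - sub_gamma \<theta> * nu lam (a \<omega>)))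
        \<le> H \<omega> * ennreal (exp (\<theta> * excess lam (b \<omega>) (q \<omega>)))"
      by (simp add: H_def mult.assoc ennreal_mult mult_left_mono)
  qed simp
  also have "\<dots> \<le> (\<integral>\<^sup>+\<omega>\<in>B. H \<omega> * ennreal (exp (sub_gamma \<theta> * nu lam (b \<omega>))) \<partial>M)"
    using a by (intro set_nn_integral_exp_excess_le \<theta> lam) (auto simp: b_def)
  also have "\<dots> = (\<integral>\<^sup>+\<omega>\<in>B. G \<omega> \<partial>M)"
    by (simp add: H_def mult.assoc flip: ennreal_mult exp_add)
  finally show ?thesis .
qed

end

section \<open>Ville's inequality\<close>

locale nonneg_supermartingale =
  fixes M :: "'a measure" and F :: "nat \<Rightarrow> 'a measure" and S :: "nat \<Rightarrow> 'a \<Rightarrow> ennreal"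
  assumes subalg: "subalgebra M (F n)" and mono: "sets (F n) \<subseteq> sets (F (Suc n))"
    and adapted: "S n \<in> borel_measurable (F n)"
    and set_nn_integral_Suc_le:
      "A \<in> sets (F n) \<Longrightarrow> (\<integral>\<^sup>+\<omega>\<in>A. S (Suc n) \<omega> \<partial>M) \<le> (\<integral>\<^sup>+\<omega>\<in>A. S n \<omega> \<partial>M)"
begin

definition reached :: "ennreal \<Rightarrow> nat \<Rightarrow> 'a set" where
  "reached c n = {\<omega> \<in> space M. \<exists>k\<le>n. c \<le> S k \<omega>}"

lemma space_F: "space (F n) = space M"
  using subalg by (simp add: subalgebra_def)

lemma borel_measurable_S [measurable]: "S n \<in> borel_measurable M"
  by (rule measurable_from_subalg[OF subalg adapted])

lemma reached_in_sets_F: "reached c n \<in> sets (F n)"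
proof -
  have "{\<omega> \<in> space M. c \<le> S k \<omega>} \<in> sets (F k)" for k
    using adapted[of k] by (simp flip: space_F[of k])
  moreover have "sets (F k) \<subseteq> sets (F n)" if "k \<le> n" for k
    using mono that by (rule lift_Suc_mono_le)
  ultimately have "(\<Union>k\<le>n. {\<omega> \<in> space M. c \<le> S k \<omega>}) \<in> sets (F n)"
    by (intro sets.finite_UN) auto
  also have "(\<Union>k\<le>n. {\<omega> \<in> space M. c \<le> S k \<omega>}) = reached c n" by (auto simp: reached_def)
  finally show ?thesis .
qed

lemma reached_in_sets [measurable]: "reached c n \<in> sets M"
  using reached_in_sets_F[of c n] subalg[of n] unfolding subalgebra_def by blast

lemma stopped_nn_integral_le:
  "c * emeasure M (reached c n) + (\<integral>\<^sup>+\<omega>\<in>space M - reached c n. S n \<omega> \<partial>M) \<le> (\<integral>\<^sup>+\<omega>. S 0 \<omega> \<partial>M)"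
proof (induction n)
  case 0
  have "c * emeasure M (reached c 0) + (\<integral>\<^sup>+\<omega>\<in>space M - reached c 0. S 0 \<omega> \<partial>M)
      = (\<integral>\<^sup>+\<omega>. c * indicator (reached c 0) \<omega> + S 0 \<omega> * indicator (space M - reached c 0) \<omega> \<partial>M)"
    by (simp add: nn_integral_add nn_integral_cmult)
  also have "\<dots> \<le> (\<integral>\<^sup>+\<omega>. S 0 \<omega> \<partial>M)"
    by (intro nn_integral_mono) (auto simp: reached_def indicator_def)
  finally show ?case .
next
  case (Suc n)
  let ?new = "reached c (Suc n) - reached c n"
  have "emeasure M (reached c (Suc n)) = emeasure M (reached c n) + emeasure M ?new"
    by (subst plus_emeasure)
      (auto simp: reached_def intro!: arg_cong[where f = "emeasure M"] intro: le_SucI)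
  then have "c * emeasure M (reached c (Suc n)) + (\<integral>\<^sup>+\<omega>\<in>space M - reached c (Suc n). S (Suc n) \<omega> \<partial>M)
      = c * emeasure M (reached c n)
        + (\<integral>\<^sup>+\<omega>. c * indicator ?new \<omega> + S (Suc n) \<omega> * indicator (space M - reached c (Suc n)) \<omega> \<partial>M)"
    by (simp add: nn_integral_add nn_integral_cmult distrib_left add.assoc)
  also have "\<dots> \<le> c * emeasure M (reached c n) + (\<integral>\<^sup>+\<omega>\<in>space M - reached c n. S (Suc n) \<omega> \<partial>M)"
    by (intro add_left_mono nn_integral_mono) (auto simp: reached_def indicator_def le_Suc_eq)
  also have "\<dots> \<le> c * emeasure M (reached c n) + (\<integral>\<^sup>+\<omega>\<in>space M - reached c n. S n \<omega> \<partial>M)"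
    using reached_in_sets_F
    by (intro add_left_mono set_nn_integral_Suc_le) (auto simp flip: space_F[of n])
  finally show ?case using Suc.IH by (rule order_trans)
qed

lemma ville_inequality: "c * emeasure M {\<omega> \<in> space M. \<exists>n. c \<le> S n \<omega>} \<le> (\<integral>\<^sup>+\<omega>. S 0 \<omega> \<partial>M)"
proof -
  have "{\<omega> \<in> space M. \<exists>n. c \<le> S n \<omega>} = (\<Union>n. reached c n)" by (auto simp: reached_def)
  also have "c * emeasure M \<dots> = (SUP n. c * emeasure M (reached c n))"
    by (subst SUP_emeasure_incseq[symmetric])
      (auto simp: SUP_mult_left_ennreal incseq_def reached_def intro: order_trans)
  also have "\<dots> \<le> (\<integral>\<^sup>+\<omega>. S 0 \<omega> \<partial>M)"
    by (intro SUP_least order_trans[OF add_increasing2[OF _ order_refl] stopped_nn_integral_le]) simp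
  finally show ?thesis .
qed

end

section \<open>Dyadic stitching\<close>

lemma one_less_kappa: "1 < kappa"
proof -
  have "3 * 3 < pi * pi" using pi_gt3 by (intro mult_strict_mono) auto
  then show ?thesis by (simp add: kappa_def power2_eq_square)
qed

definition block_level :: "real \<Rightarrow> nat \<Rightarrow> real" where
  "block_level \<delta> j = \<delta> / (1 + kappa) * (1 / (1 + real j)\<^sup>2 + of_bool (j = 0))"

lemma block_level_sums: "block_level \<delta> sums \<delta>"
proof -
  have "(\<lambda>j. 1 / (1 + real j)\<^sup>2) sums kappa"
    using inverse_squares_sums by (simp add: kappa_def add.commute)
  moreover have "(\<lambda>j::nat. of_bool (j = 0)) sums (1::real)"
    using sums_single[of 0 "\<lambda>_. 1::real"] by (simp add: of_bool_def)
  ultimately have "block_level \<delta> sums (\<delta> / (1 + kappa) * (kappa + 1))"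
    unfolding block_level_def by (intro sums_mult sums_add)
  then show ?thesis using one_less_kappa by (simp add: add.commute)
qed

definition block_cost :: "real \<Rightarrow> nat \<Rightarrow> real" where
  "block_cost \<delta> j = - ln (block_level \<delta> j)"

lemma exp_minus_block_cost: "0 < \<delta> \<Longrightarrow> exp (- block_cost \<delta> j) = block_level \<delta> j"
  using one_less_kappa
  by (simp add: block_cost_def block_level_def add_pos_nonneg)

lemma block_cost_0: "0 < \<delta> \<Longrightarrow> block_cost \<delta> 0 = ln ((1 + kappa) / \<delta>) - ln 2"
  using one_less_kappa by (simp add: block_cost_def block_level_def ln_div ln_mult)

lemma block_cost_eq:
  "0 < \<delta> \<Longrightarrow> 0 < j \<Longrightarrow> block_cost \<delta> j = ln ((1 + kappa) / \<delta>) + 2 * ln (1 + real j)"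
  using one_less_kappa by (simp add: block_cost_def block_level_def ln_div ln_mult ln_realpow)

lemma ln_2_less_ln_one_plus_kappa_div:
  assumes "0 < \<delta>" "\<delta> < 1"
  shows "ln 2 < ln ((1 + kappa) / \<delta>)"
  using assms one_less_kappa by (subst ln_less_cancel_iff) (auto simp: field_simps)

lemma block_cost_pos:
  assumes "0 < \<delta>" "\<delta> < 1"
  shows "0 < block_cost \<delta> j"
proof (cases "j = 0")
  case True
  then show ?thesis using ln_2_less_ln_one_plus_kappa_div[OF assms] assms by (simp add: block_cost_0)
next
  case False
  have "0 < ln (2::real)" "0 \<le> ln (1 + real j)" by simp_all
  then have "0 < ln ((1 + kappa) / \<delta>) + 2 * ln (1 + real j)"
    using ln_2_less_ln_one_plus_kappa_div[OF assms] by linarith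
  then show ?thesis using False assms(1) by (simp add: block_cost_eq)
qed

lemma block_cost_0_le_eps:
  assumes "0 < \<delta>"
  shows "block_cost \<delta> 0 + ln 2 \<le> eps \<delta> u"
  using assms by (simp add: block_cost_0 eps_def zero_le_log_cancel_iff)

lemma block_cost_le_eps:
  assumes "0 < \<delta>" "0 < j" "2 ^ j \<le> u"
  shows "block_cost \<delta> j \<le> eps \<delta> u"
proof -
  have "1 \<le> u" using order_trans[OF one_le_power assms(3)] by simp
  then have "real j \<le> log 2 u"
    using assms(3) by (simp add: le_log_iff powr_realpow)
  then show ?thesis
    using assms \<open>1 \<le> u\<close> by (simp add: block_cost_eq eps_def max_def)
qed

lemma eps_mono: "u \<le> v \<Longrightarrow> eps \<delta> u \<le> eps \<delta> v"
  by (auto simp: eps_def add_pos_nonneg)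

lemma eps_pos:
  assumes "0 < \<delta>" "\<delta> < 1"
  shows "0 < eps \<delta> u"
  using block_cost_0_le_eps[OF assms(1), of u] block_cost_pos[OF assms, of 0] ln_gt_zero[of "2::real"]
  by linarith

lemma Delta_mono:
  assumes "0 < \<delta>" "\<delta> < 1" "u \<le> v"
  shows "Delta \<delta> u \<le> Delta \<delta> v"
  unfolding Delta_def using eps_mono[OF assms(3)] eps_pos[OF assms(1,2)] assms(3)
  by (intro add_mono mult_mono) (auto simp: less_imp_le)

lemma borel_measurable_Delta [measurable]: "Delta \<delta> \<in> borel_measurable borel"
  unfolding Delta_def eps_def by measurable

definition crossing_line :: "real \<Rightarrow> real \<Rightarrow> real \<Rightarrow> real" where
  "crossing_line e x u = x / 2 * u + e / x + e / 2"

lemma crossing_line_le_sqrt: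
  assumes "0 < e" "0 < v" "v \<le> u" "u \<le> 4 * v"
  shows "crossing_line e (sqrt (e / v)) u \<le> 3 / 2 * sqrt e * sqrt u + e / 2"
proof -
  define r w y where "r = sqrt e" and "w = sqrt v" and "y = sqrt u"
  have pos: "0 < r" "0 < w" "0 \<le> y" using assms by (auto simp: r_def w_def y_def)
  have sq: "e = r\<^sup>2" "v = w\<^sup>2" "u = y\<^sup>2" using assms by (auto simp: r_def w_def y_def)
  have "w \<le> y" "y \<le> 2 * w"
    using assms real_sqrt_le_mono[OF assms(4)] by (auto simp: w_def y_def real_sqrt_mult)
  then have "(y - w) * (y - 2 * w) \<le> 0" by (intro mult_nonneg_nonpos) auto
  then have "r * (y\<^sup>2 + 2 * w\<^sup>2) \<le> r * (3 * y * w)"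
    using pos by (intro mult_left_mono) (auto simp: power2_eq_square algebra_simps)
  then have "r / w / 2 * y\<^sup>2 + r * w \<le> 3 / 2 * r * y"
    using pos by (simp add: field_simps power2_eq_square)
  moreover have "crossing_line e (sqrt (e / v)) u = r / w / 2 * y\<^sup>2 + r * w + e / 2"
    using pos by (simp add: crossing_line_def sq real_sqrt_divide power2_eq_square)
  ultimately show ?thesis by (simp add: r_def y_def)
qed

definition block_line :: "real \<Rightarrow> nat \<Rightarrow> real \<Rightarrow> real" where
  "block_line \<delta> j = crossing_line (block_cost \<delta> j) (sqrt (block_cost \<delta> j / 2 ^ j))"

lemma block_line_mono:
  assumes "0 < \<delta>" "\<delta> < 1" "u \<le> v"
  shows "block_line \<delta> j u \<le> block_line \<delta> j v"
  using assms block_cost_pos[OF assms(1,2), of j]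
  by (simp add: block_line_def crossing_line_def mult_left_mono)

lemma block_line_le_sqrt:
  assumes "0 < \<delta>" "\<delta> < 1" "2 ^ j \<le> u" "u \<le> 2 ^ Suc j"
  shows "block_line \<delta> j u \<le> 3 / 2 * sqrt (block_cost \<delta> j) * sqrt u + block_cost \<delta> j / 2"
  unfolding block_line_def
proof (rule crossing_line_le_sqrt[OF block_cost_pos[OF assms(1,2)] _ assms(3)])
  show "u \<le> 4 * 2 ^ j" using assms(4) by (rule order_trans) simp
qed simp

lemma three_halves_sqrt_add_le_two_sqrt:
  fixes e f :: real
  assumes "0 \<le> e" "e + 2 / 3 \<le> f"
  shows "3 / 2 * sqrt e + 7 / 10 \<le> 2 * sqrt f"
proof -
  have "0 \<le> (sqrt e - 3 / 5)\<^sup>2" by simp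
  then have "21 / 10 * sqrt e \<le> 7 / 4 * e + 63 / 100"
    using assms by (simp add: power2_eq_square algebra_simps)
  moreover have "(3 / 2 * sqrt e + 7 / 10)\<^sup>2 = 9 / 4 * e + 21 / 10 * sqrt e + 49 / 100"
    using assms by (simp add: power2_eq_square algebra_simps)
  ultimately have "(3 / 2 * sqrt e + 7 / 10)\<^sup>2 \<le> 4 * f" using assms(2) by linarith
  then have "3 / 2 * sqrt e + 7 / 10 \<le> sqrt (4 * f)" by (rule real_le_rsqrt)
  then show ?thesis by (simp add: real_sqrt_mult)
qed

lemma block_line_0_le_Delta:
  assumes \<delta>: "0 < \<delta>" "\<delta> < 1" and "u \<le> 2"
  shows "block_line \<delta> 0 u + 1 \<le> Delta \<delta> u"
proof -
  define e f v where "e = block_cost \<delta> 0" and "f = eps \<delta> u" and "v = max u 1"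
  have v: "1 \<le> sqrt v" by (simp add: v_def)
  have e: "0 \<le> e" using block_cost_pos[OF \<delta>] by (simp add: e_def less_imp_le)
  have f: "e + 2 / 3 \<le> f"
    using block_cost_0_le_eps[OF \<delta>(1), of u] ln2_ge_two_thirds by (simp add: e_def f_def)
  \<comment> \<open>The gap is \<open>7/10\<close> from the square roots and \<open>1/3\<close> from the terms \<open>e / 2\<close> and \<open>f / 2\<close>.\<close>
  have "block_line \<delta> 0 u \<le> block_line \<delta> 0 v"
    by (intro block_line_mono \<delta>) (simp add: v_def)
  also have "\<dots> \<le> 3 / 2 * sqrt e * sqrt v + e / 2"
    unfolding e_def using assms by (intro block_line_le_sqrt) (auto simp: v_def)
  also have "3 / 2 * sqrt e * sqrt v \<le> (2 * sqrt f - 7 / 10) * sqrt v"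
    using three_halves_sqrt_add_le_two_sqrt[OF e f] v by (intro mult_right_mono) auto
  finally have "block_line \<delta> 0 u \<le> 2 * sqrt f * sqrt v + f / 2 - 7 / 10 * sqrt v - 1 / 3"
    using f by (simp add: algebra_simps)
  then have "block_line \<delta> 0 u + 1 \<le> 2 * sqrt f * sqrt v + f / 2" using v by linarith
  then show ?thesis by (simp add: Delta_def f_def v_def)
qed

lemma block_line_le_Delta:
  assumes \<delta>: "0 < \<delta>" "\<delta> < 1" and j: "0 < j" "2 ^ j \<le> u" "u \<le> 2 ^ Suc j"
  shows "block_line \<delta> j u + 1 \<le> Delta \<delta> u"
proof -
  define e f where "e = block_cost \<delta> j" and "f = eps \<delta> u"
  have "(2::real) ^ 1 \<le> 2 ^ j" using j(1) by (intro power_increasing) auto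
  then have u: "2 \<le> u" using j(2) by simp
  have "ln 2 \<le> ln (1 + real j)" using j(1) by simp
  then have e: "2 \<le> e"
    using ln_2_less_ln_one_plus_kappa_div[OF \<delta>] ln2_ge_two_thirds
    unfolding e_def block_cost_eq[OF \<delta>(1) j(1)] by linarith
  have f: "e \<le> f" unfolding e_def f_def by (rule block_cost_le_eps[OF \<delta>(1) j(1,2)])
  have "sqrt 2 * sqrt 2 \<le> sqrt f * sqrt u" using e f u by (intro mult_mono) auto
  moreover have "sqrt e * sqrt u \<le> sqrt f * sqrt u" using f u by (intro mult_right_mono) auto
  moreover have "block_line \<delta> j u \<le> 3 / 2 * (sqrt e * sqrt u) + e / 2"
    using block_line_le_sqrt[OF \<delta> j(2,3)] by (simp add: e_def mult.assoc)
  ultimately have "block_line \<delta> j u + 1 \<le> 2 * (sqrt f * sqrt u) + f / 2" using f by simp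
  then show ?thesis using u by (simp add: Delta_def f_def max_def mult.assoc)
qed

lemma ex_block_line_le_Delta:
  assumes \<delta>: "0 < \<delta>" "\<delta> < 1"
  shows "\<exists>j. block_line \<delta> j u + 1 \<le> Delta \<delta> u"
proof (cases "u \<le> 2")
  case True
  then show ?thesis using block_line_0_le_Delta[OF \<delta>] by blast
next
  case False
  define j where "j = nat \<lfloor>log 2 u\<rfloor>"
  have "1 \<le> log 2 u" using False by (subst le_log_iff) auto
  then have j: "real j \<le> log 2 u" "log 2 u < real j + 1" "0 < j"
    unfolding j_def by (auto simp: zero_less_nat_eq)
  then have "2 ^ j \<le> u" "u \<le> 2 ^ Suc j"
    using False by (auto simp: le_log_iff log_less_iff powr_realpow powr_add)
  then show ?thesis using block_line_le_Delta[OF \<delta> j(3)] by blast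
qed

section \<open>Sequential testing with conditionally superuniform p-values\<close>

text \<open>\<open>K\<close> is the set of steps about which something is assumed; it will omit the first step and
  the steps beyond the last hypothesis.\<close>
locale superuniform_tests = prob_space M for M :: "'a measure" +
  fixes F :: "nat \<Rightarrow> 'a measure" and K :: "nat set" and B :: "nat \<Rightarrow> 'a set"
    and q a :: "nat \<Rightarrow> 'a \<Rightarrow> real" and lam :: real
  assumes subalg: "subalgebra M (F n)" and mono: "sets (F n) \<subseteq> sets (F (Suc n))"
    and null_event: "Suc n \<in> K \<Longrightarrow> B (Suc n) \<in> sets (F (Suc n))"
    and rejection_event: "Suc n \<in> K \<Longrightarrow> {\<omega> \<in> space M. q (Suc n) \<omega> \<le> a (Suc n) \<omega>} \<in> sets (F (Suc n))"
    and large_pvalue_event: "Suc n \<in> K \<Longrightarrow> {\<omega> \<in> space M. lam < q (Suc n) \<omega>} \<in> sets (F (Suc n))"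
    and level_predictable: "Suc n \<in> K \<Longrightarrow> a (Suc n) \<in> borel_measurable (F n)"
    and superuniform: "Suc n \<in> K \<Longrightarrow> cond_superuniform M (F n) (B (Suc n)) (q (Suc n))"
    and pvalue_le_1: "k \<in> K \<Longrightarrow> \<omega> \<in> space M \<Longrightarrow> q k \<omega> \<le> 1"
    and level_nonneg: "k \<in> K \<Longrightarrow> \<omega> \<in> space M \<Longrightarrow> 0 \<le> a k \<omega>"
    and lam: "0 \<le> lam" "lam < 1"
begin

definition excess_sum :: "nat \<Rightarrow> 'a \<Rightarrow> real" where
  "excess_sum n \<omega> = (\<Sum>k=1..n. of_bool (k \<in> K \<and> \<omega> \<in> B k) * excess lam (a k \<omega>) (q k \<omega>))"

definition nu_sum :: "nat \<Rightarrow> 'a \<Rightarrow> real" where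
  "nu_sum n \<omega> = (\<Sum>k=1..n. of_bool (k \<in> K \<and> \<omega> \<in> B k) * nu lam (a k \<omega>))"

lemma excess_sum_0 [simp]: "excess_sum 0 \<omega> = 0" and nu_sum_0 [simp]: "nu_sum 0 \<omega> = 0"
  by (simp_all add: excess_sum_def nu_sum_def)

lemma excess_sum_Suc: "excess_sum (Suc n) \<omega> = excess_sum n \<omega>
    + of_bool (Suc n \<in> K \<and> \<omega> \<in> B (Suc n)) * excess lam (a (Suc n) \<omega>) (q (Suc n) \<omega>)"
  unfolding excess_sum_def by (subst sum.nat_ivl_Suc') simp_all

lemma nu_sum_Suc: "nu_sum (Suc n) \<omega> = nu_sum n \<omega>
    + of_bool (Suc n \<in> K \<and> \<omega> \<in> B (Suc n)) * nu lam (a (Suc n) \<omega>)"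
  unfolding nu_sum_def by (subst sum.nat_ivl_Suc') simp_all

lemma borel_measurable_F_Suc: "f \<in> borel_measurable (F n) \<Longrightarrow> f \<in> borel_measurable (F (Suc n))"
  by (rule measurable_from_subalg[of "F (Suc n)" "F n"])
    (use subalg mono in \<open>auto simp: subalgebra_def\<close>)

lemma sums_adapted: "excess_sum n \<in> borel_measurable (F n)" "nu_sum n \<in> borel_measurable (F n)"
proof (induction n)
  case 0
  show "excess_sum 0 \<in> borel_measurable (F 0)" and "nu_sum 0 \<in> borel_measurable (F 0)"
    by (simp_all add: excess_sum_0[abs_def] nu_sum_0[abs_def])
next
  case (Suc n)
  have space_F: "space (F n) = space M" for n using subalg by (simp add: subalgebra_def)
  note [measurable] = borel_measurable_F_Suc[OF Suc(1)] borel_measurable_F_Suc[OF Suc(2)]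
  have [measurable]: "B (Suc n) \<in> sets (F (Suc n))" "a (Suc n) \<in> borel_measurable (F (Suc n))"
    "Measurable.pred (F (Suc n)) (\<lambda>\<omega>. q (Suc n) \<omega> \<le> a (Suc n) \<omega>)"
    "Measurable.pred (F (Suc n)) (\<lambda>\<omega>. lam < q (Suc n) \<omega>)" if "Suc n \<in> K"
    using null_event level_predictable rejection_event large_pvalue_event that
    by (auto simp: pred_def space_F intro: borel_measurable_F_Suc)
  show "excess_sum (Suc n) \<in> borel_measurable (F (Suc n))"
    unfolding excess_sum_Suc[abs_def] excess_def by (cases "Suc n \<in> K"; simp; measurable)
  show "nu_sum (Suc n) \<in> borel_measurable (F (Suc n))"
    unfolding nu_sum_Suc[abs_def] by (cases "Suc n \<in> K"; simp; measurable)
qed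

definition exp_process :: "real \<Rightarrow> nat \<Rightarrow> 'a \<Rightarrow> real" where
  "exp_process \<theta> n \<omega> = exp (\<theta> * excess_sum n \<omega> - sub_gamma \<theta> * nu_sum n \<omega>)"

lemma exp_process_adapted: "exp_process \<theta> n \<in> borel_measurable (F n)"
  using sums_adapted[of n, measurable] unfolding exp_process_def by measurable

lemma set_nn_integral_exp_process_Suc_le:
  assumes \<theta>: "0 \<le> \<theta>" "\<theta> < 2" and A: "A \<in> sets (F n)"
  shows "(\<integral>\<^sup>+\<omega>\<in>A. ennreal (exp_process \<theta> (Suc n) \<omega>) \<partial>M) \<le> (\<integral>\<^sup>+\<omega>\<in>A. ennreal (exp_process \<theta> n \<omega>) \<partial>M)"
proof (cases "Suc n \<in> K")
  case False
  then show ?thesis by (simp add: exp_process_def excess_sum_Suc nu_sum_Suc)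
next
  case True
  interpret cond_superuniform M "F n" "B (Suc n)" "q (Suc n)" by (rule superuniform[OF True])
  have [measurable]: "A \<in> sets M" using A subalg by (auto simp: subalgebra_def)
  note [measurable] = A exp_process_adapted
  let ?G = "\<lambda>\<omega>. ennreal (exp_process \<theta> n \<omega>) * indicator A \<omega>"
  let ?d = "\<lambda>\<omega>. \<theta> * excess lam (a (Suc n) \<omega>) (q (Suc n) \<omega>) - sub_gamma \<theta> * nu lam (a (Suc n) \<omega>)"
  have step: "exp_process \<theta> (Suc n) \<omega>
      = exp_process \<theta> n \<omega> * (if \<omega> \<in> B (Suc n) then exp (?d \<omega>) else 1)" for \<omega>
    using True by (simp add: exp_process_def excess_sum_Suc nu_sum_Suc algebra_simps flip: exp_add)
  have nonneg: "0 \<le> exp_process \<theta> n \<omega>" for \<omega> by (simp add: exp_process_def)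
  have "(\<integral>\<^sup>+\<omega>\<in>A. ennreal (exp_process \<theta> (Suc n) \<omega>) \<partial>M)
      = (\<integral>\<^sup>+\<omega>. ?G \<omega> * indicator (- B (Suc n)) \<omega>
          + ?G \<omega> * ennreal (exp (?d \<omega>)) * indicator (B (Suc n)) \<omega> \<partial>M)"
    by (intro nn_integral_cong) (auto simp: step nonneg indicator_def ennreal_mult)
  also have "\<dots> = (\<integral>\<^sup>+\<omega>. ?G \<omega> * indicator (- B (Suc n)) \<omega> \<partial>M)
      + (\<integral>\<^sup>+\<omega>\<in>B (Suc n). ?G \<omega> * ennreal (exp (?d \<omega>)) \<partial>M)"
    using level_predictable[OF True] by (intro nn_integral_add) auto
  also have "\<dots> \<le> (\<integral>\<^sup>+\<omega>. ?G \<omega> * indicator (- B (Suc n)) \<omega> \<partial>M) + (\<integral>\<^sup>+\<omega>\<in>B (Suc n). ?G \<omega> \<partial>M)"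
    using level_predictable[OF True] level_nonneg[OF True] pvalue_le_1[OF True]
    by (intro add_left_mono set_nn_integral_exp_compensated_excess_le \<theta> lam) auto
  also have "\<dots> = (\<integral>\<^sup>+\<omega>. ?G \<omega> * indicator (- B (Suc n)) \<omega> + ?G \<omega> * indicator (B (Suc n)) \<omega> \<partial>M)"
    by (intro nn_integral_add[symmetric]) auto
  also have "\<dots> = (\<integral>\<^sup>+\<omega>\<in>A. ennreal (exp_process \<theta> n \<omega>) \<partial>M)"
    by (intro nn_integral_cong) (auto simp: indicator_def)
  finally show ?thesis .
qed

lemma exp_process_supermartingale:
  assumes "0 \<le> \<theta>" "\<theta> < 2"
  shows "nonneg_supermartingale M F (\<lambda>n \<omega>. ennreal (exp_process \<theta> n \<omega>))"
  using assms by unfold_locales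
    (auto intro!: subalg subsetD[OF mono] measurable_compose[OF exp_process_adapted]
      set_nn_integral_exp_process_Suc_le)

lemma prob_exp_process_ge:
  assumes \<theta>: "0 \<le> \<theta>" "\<theta> < 2" and c: "0 < c"
  shows "prob {\<omega> \<in> space M. \<exists>n. c \<le> exp_process \<theta> n \<omega>} \<le> 1 / c"
proof -
  let ?E = "{\<omega> \<in> space M. \<exists>n. c \<le> exp_process \<theta> n \<omega>}"
  have "?E = {\<omega> \<in> space M. \<exists>n. ennreal c \<le> ennreal (exp_process \<theta> n \<omega>)}"
    by (simp add: exp_process_def ennreal_le_iff)
  also have "ennreal c * emeasure M \<dots> \<le> (\<integral>\<^sup>+\<omega>. ennreal (exp_process \<theta> 0 \<omega>) \<partial>M)"
    by (rule nonneg_supermartingale.ville_inequality[OF exp_process_supermartingale[OF \<theta>]])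
  also have "\<dots> = 1" by (simp add: exp_process_def emeasure_space_1)
  finally have "ennreal (c * prob ?E) \<le> ennreal 1"
    using c by (simp add: emeasure_eq_measure ennreal_mult)
  then show ?thesis using c by (simp add: ennreal_le_iff field_simps del: ennreal_1)
qed

lemma prob_excess_sum_ge_crossing_line:
  assumes "0 < x"
  shows "prob {\<omega> \<in> space M. \<exists>n. crossing_line e x (nu_sum n \<omega>) \<le> excess_sum n \<omega>} \<le> exp (- e)"
proof -
  define \<theta> where "\<theta> = 2 * x / (2 + x)"
  have \<theta>: "0 < \<theta>" "\<theta> < 2" using assms by (auto simp: \<theta>_def field_simps)
  have scale: "\<theta> * crossing_line e x u = sub_gamma \<theta> * u + e" for u
  proof -
    have "sub_gamma \<theta> = \<theta> * (x / 2)"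
      using assms by (simp add: \<theta>_def sub_gamma_def power2_eq_square divide_simps)
    moreover have "e / x + e / 2 = e / \<theta>"
      using assms by (simp add: \<theta>_def field_simps)
    ultimately show ?thesis using \<theta>(1) by (simp add: crossing_line_def distrib_left add.assoc)
  qed
  have "crossing_line e x (nu_sum n \<omega>) \<le> excess_sum n \<omega> \<longleftrightarrow> exp e \<le> exp_process \<theta> n \<omega>" for n \<omega>
  proof -
    have "crossing_line e x (nu_sum n \<omega>) \<le> excess_sum n \<omega>
        \<longleftrightarrow> \<theta> * crossing_line e x (nu_sum n \<omega>) \<le> \<theta> * excess_sum n \<omega>"
      using \<theta> by simp
    then show ?thesis by (simp add: scale exp_process_def le_diff_eq add.commute)
  qed
  then show ?thesis using prob_exp_process_ge[of \<theta> "exp e"] \<theta> by (simp add: exp_minus field_simps)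
qed

lemma borel_measurable_sums [measurable]:
  "excess_sum n \<in> borel_measurable M" "nu_sum n \<in> borel_measurable M"
  by (rule measurable_from_subalg[OF subalg], rule sums_adapted)+

lemma prob_Delta_nu_sum_less_excess_sum:
  assumes \<delta>: "0 < \<delta>" "\<delta> < 1"
  shows "prob {\<omega> \<in> space M. \<exists>n. Delta \<delta> (nu_sum n \<omega>) < excess_sum n \<omega> + 1} \<le> \<delta>"
proof -
  define Cross where "Cross j = {\<omega> \<in> space M. \<exists>n. block_line \<delta> j (nu_sum n \<omega>) \<le> excess_sum n \<omega>}" for j
  have [measurable]: "Cross j \<in> sets M" for j
    unfolding Cross_def block_line_def crossing_line_def by measurable
  have Cross: "prob (Cross j) \<le> block_level \<delta> j" for j
    using prob_excess_sum_ge_crossing_line[of "sqrt (block_cost \<delta> j / 2 ^ j)" "block_cost \<delta> j"]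
      block_cost_pos[OF \<delta>] \<delta>
    by (simp add: Cross_def block_line_def exp_minus_block_cost)
  have summable: "summable (\<lambda>j. prob (Cross j))"
    using Cross by (intro summable_comparison_test'[OF sums_summable[OF block_level_sums]]) auto
  have "{\<omega> \<in> space M. \<exists>n. Delta \<delta> (nu_sum n \<omega>) < excess_sum n \<omega> + 1} \<subseteq> (\<Union>j. Cross j)"
  proof safe
    fix \<omega> n assume "\<omega> \<in> space M" "Delta \<delta> (nu_sum n \<omega>) < excess_sum n \<omega> + 1"
    moreover obtain j where "block_line \<delta> j (nu_sum n \<omega>) + 1 \<le> Delta \<delta> (nu_sum n \<omega>)"
      using ex_block_line_le_Delta[OF \<delta>] by blast
    ultimately have "\<omega> \<in> Cross j" unfolding Cross_def by (intro CollectI conjI exI[of _ n]) auto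
    then show "\<omega> \<in> (\<Union>j. Cross j)" by blast
  qed
  then have "prob {\<omega> \<in> space M. \<exists>n. Delta \<delta> (nu_sum n \<omega>) < excess_sum n \<omega> + 1} \<le> prob (\<Union>j. Cross j)"
    by (intro finite_measure_mono) auto
  also have "\<dots> \<le> (\<Sum>j. prob (Cross j))"
    using summable by (intro finite_measure_subadditive_countably) auto
  also have "\<dots> \<le> (\<Sum>j. block_level \<delta> j)"
    by (intro suminf_le Cross summable sums_summable[OF block_level_sums])
  also have "\<dots> = \<delta>" using block_level_sums by (simp add: sums_iff)
  finally show ?thesis .
qed

end

section \<open>Ordered p-values\<close>

lemma hyp_index_mono: "k \<in> hyp_index m \<Longrightarrow> 1 \<le> i \<Longrightarrow> i \<le> k \<Longrightarrow> i \<in> hyp_index m"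
  unfolding hyp_index_def by (auto intro: order_trans[of "enat i" "enat k"])

lemma space_pval_filtration [simp]: "space (pval_filtration M p ord \<alpha> lam k) = space M"
  unfolding pval_filtration_def by (rule space_measure_of) auto

lemma sets_pval_filtration:
  "sets (pval_filtration M p ord \<alpha> lam k) = sigma_sets (space M)
     ({{\<omega> \<in> space M. ord i \<omega> = j} | i j. i \<in> {1..k}}
      \<union> {{\<omega> \<in> space M. p (ord i \<omega>) \<omega> \<le> \<alpha> i \<omega>} | i. i \<in> {1..k}}
      \<union> {{\<omega> \<in> space M. p (ord i \<omega>) \<omega> > lam} | i. i \<in> {1..k}})"
  unfolding pval_filtration_def by (rule sets_measure_of) auto

lemma sets_pval_filtration_mono:
  "k \<le> l \<Longrightarrow> sets (pval_filtration M p ord \<alpha> lam k) \<subseteq> sets (pval_filtration M p ord \<alpha> lam l)"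
  unfolding sets_pval_filtration by (intro sigma_sets_mono') fastforce

lemma pval_filtration_events:
  assumes "1 \<le> k"
  shows "{\<omega> \<in> space M. ord k \<omega> = j} \<in> sets (pval_filtration M p ord \<alpha> lam k)"
    and "{\<omega> \<in> space M. p (ord k \<omega>) \<omega> \<le> \<alpha> k \<omega>} \<in> sets (pval_filtration M p ord \<alpha> lam k)"
    and "{\<omega> \<in> space M. lam < p (ord k \<omega>) \<omega>} \<in> sets (pval_filtration M p ord \<alpha> lam k)"
  using assms unfolding sets_pval_filtration by (auto intro!: sigma_sets.Basic)

lemma pval_filtration_ord_event:
  assumes "1 \<le> k"
  shows "{\<omega> \<in> space M. ord k \<omega> \<in> J} \<in> sets (pval_filtration M p ord \<alpha> lam k)"
proof -
  have "{\<omega> \<in> space M. ord k \<omega> \<in> J} = (\<Union>j\<in>J. {\<omega> \<in> space M. ord k \<omega> = j})" by auto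
  also have "\<dots> \<in> sets (pval_filtration M p ord \<alpha> lam k)"
    using assms by (intro sets.countable_UN') (auto intro!: pval_filtration_events)
  finally show ?thesis .
qed

locale ordered_pvalues = prob_space M for M :: "'a measure" +
  fixes m :: enat and h :: "nat \<Rightarrow> real"
    and p :: "nat \<Rightarrow> 'a \<Rightarrow> real" and ord :: "nat \<Rightarrow> 'a \<Rightarrow> nat" and \<alpha> :: "nat \<Rightarrow> 'a \<Rightarrow> real"
    and lam :: real
  assumes status: "h i \<in> {0, 1}"
    and p_measurable: "i \<in> hyp_index m \<Longrightarrow> p i \<in> borel_measurable M"
    and p_le_1: "i \<in> hyp_index m \<Longrightarrow> \<omega> \<in> space M \<Longrightarrow> p i \<omega> \<le> 1"
    and ord_measurable: "i \<in> hyp_index m \<Longrightarrow> ord i \<in> measurable M (count_space UNIV)"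
    and ord_mem_hyp_index: "i \<in> hyp_index m \<Longrightarrow> \<omega> \<in> space M \<Longrightarrow> ord i \<omega> \<in> hyp_index m"
    and alpha_measurable: "i \<in> hyp_index m \<Longrightarrow> \<alpha> i \<in> borel_measurable M"
    and alpha_nonneg: "i \<in> hyp_index m \<Longrightarrow> \<omega> \<in> space M \<Longrightarrow> 0 \<le> \<alpha> i \<omega>"
    and lam_nonneg: "0 \<le> lam" and lam_less_1: "lam < 1"
    and alpha_predictable: "k \<in> hyp_index m \<Longrightarrow> 2 \<le> k \<Longrightarrow>
      \<alpha> k \<in> borel_measurable (pval_filtration M p ord \<alpha> lam (k - 1))"
    and null_superuniform: "k \<in> hyp_index m \<Longrightarrow> 2 \<le> k \<Longrightarrow> t \<in> {0..1} \<Longrightarrow>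
      AE \<omega> in M. cond_prob_given M (pval_filtration M p ord \<alpha> lam (k - 1))
        {\<omega> \<in> space M. h (ord k \<omega>) = 0} {\<omega> \<in> space M. p (ord k \<omega>) \<omega> \<le> t} \<omega> \<le> t"
begin

lemma inspected_pvalue_measurable:
  assumes "k \<in> hyp_index m"
  shows "(\<lambda>\<omega>. p (ord k \<omega>) \<omega>) \<in> borel_measurable M"
proof (rule measurable_compose_countable'[OF p_measurable])
  show "ord k \<in> measurable M (count_space (hyp_index m))"
    using ord_measurable[OF assms] ord_mem_hyp_index[OF assms]
    by (auto simp: measurable_count_space_eq2_countable)
qed auto

lemma subalgebra_pval_filtration:
  assumes "enat k \<le> m"
  shows "subalgebra M (pval_filtration M p ord \<alpha> lam k)"
proof -
  have "{\<omega> \<in> space M. ord i \<omega> = j} \<in> sets M \<and> {\<omega> \<in> space M. p (ord i \<omega>) \<omega> \<le> \<alpha> i \<omega>} \<in> sets M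
      \<and> {\<omega> \<in> space M. lam < p (ord i \<omega>) \<omega>} \<in> sets M" if "i \<in> {1..k}" for i j
  proof -
    have i: "i \<in> hyp_index m"
      using that assms by (auto simp: hyp_index_def intro: order_trans[of "enat i" "enat k"])
    note [measurable] = ord_measurable[OF i] inspected_pvalue_measurable[OF i] alpha_measurable[OF i]
    show ?thesis by (intro conjI) measurable
  qed
  then show ?thesis
    unfolding subalgebra_def sets_pval_filtration by (intro conjI sets.sigma_sets_subset) auto
qed

definition extended_filtration :: "nat \<Rightarrow> 'a measure" where
  "extended_filtration n = (if enat n \<le> m then pval_filtration M p ord \<alpha> lam n else M)"

lemma subalgebra_extended_filtration: "subalgebra M (extended_filtration n)"
  by (simp add: extended_filtration_def subalgebra_pval_filtration) (simp add: subalgebra_def)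

lemma extended_filtration_mono: "sets (extended_filtration n) \<subseteq> sets (extended_filtration (Suc n))"
proof (cases "enat (Suc n) \<le> m")
  case True
  then have "enat n \<le> m" by (rule order_trans[rotated]) simp
  then show ?thesis using True by (simp add: extended_filtration_def sets_pval_filtration_mono)
next
  case False
  then show ?thesis
    using subalgebra_extended_filtration[of n] by (simp add: extended_filtration_def subalgebra_def)
qed

lemma extended_filtration_eq:
  "k \<in> hyp_index m \<Longrightarrow> extended_filtration k = pval_filtration M p ord \<alpha> lam k"
  by (simp add: extended_filtration_def hyp_index_def)

definition later_steps :: "nat set" where
  "later_steps = {k \<in> hyp_index m. 2 \<le> k}"

definition null_inspected :: "nat \<Rightarrow> 'a set" where
  "null_inspected k = {\<omega> \<in> space M. h (ord k \<omega>) = 0}"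

lemma cond_superuniform_inspected_pvalue:
  assumes k: "k \<in> hyp_index m" "2 \<le> k"
  shows "cond_superuniform M (pval_filtration M p ord \<alpha> lam (k - 1))
    (null_inspected k) (\<lambda>\<omega>. p (ord k \<omega>) \<omega>)"
proof (unfold_locales)
  have "enat (k - 1) \<le> m" using k by (auto simp: hyp_index_def intro: order_trans[of _ "enat k"])
  then show "subalgebra M (pval_filtration M p ord \<alpha> lam (k - 1))"
    by (rule subalgebra_pval_filtration)
  show "null_inspected k \<in> events"
    using ord_measurable[OF k(1)] unfolding null_inspected_def by measurable
qed (use inspected_pvalue_measurable null_superuniform k in \<open>auto simp: null_inspected_def\<close>)

sublocale superuniform_tests M extended_filtration later_steps
    null_inspected "\<lambda>k \<omega>. p (ord k \<omega>) \<omega>" \<alpha> lam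
proof (intro superuniform_tests.intro superuniform_tests_axioms.intro)
  fix n assume "Suc n \<in> later_steps"
  then have k: "Suc n \<in> hyp_index m" "2 \<le> Suc n" by (simp_all add: later_steps_def)
  then have Suc_n: "extended_filtration (Suc n) = pval_filtration M p ord \<alpha> lam (Suc n)"
    and n_eq: "extended_filtration n = pval_filtration M p ord \<alpha> lam n"
    by (auto intro!: extended_filtration_eq intro: hyp_index_mono)
  show "null_inspected (Suc n) \<in> sets (extended_filtration (Suc n))"
    using pval_filtration_ord_event[of "Suc n" M ord "{j. h j = 0}"]
    by (simp add: Suc_n null_inspected_def)
  show "{\<omega> \<in> space M. p (ord (Suc n) \<omega>) \<omega> \<le> \<alpha> (Suc n) \<omega>} \<in> sets (extended_filtration (Suc n))"
    "{\<omega> \<in> space M. lam < p (ord (Suc n) \<omega>) \<omega>} \<in> sets (extended_filtration (Suc n))"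
    unfolding Suc_n by (auto intro!: pval_filtration_events)
  show "\<alpha> (Suc n) \<in> borel_measurable (extended_filtration n)"
    using alpha_predictable[OF k] by (simp add: n_eq)
  show "cond_superuniform M (extended_filtration n) (null_inspected (Suc n))
      (\<lambda>\<omega>. p (ord (Suc n) \<omega>) \<omega>)"
    using cond_superuniform_inspected_pvalue[OF k] by (simp add: n_eq)
qed (use subalgebra_extended_filtration extended_filtration_mono in
    \<open>auto simp: later_steps_def
      intro: prob_space_axioms p_le_1 ord_mem_hyp_index alpha_nonneg lam_nonneg lam_less_1\<close>)

lemma one_minus_status: "1 - h i = of_bool (h i = 0)"
  using status[of i] by auto

lemma sum_excess_le_excess_sum:
  assumes "k \<in> hyp_index m" "\<omega> \<in> space M"
  shows "(\<Sum>i=1..k. (1 - h (ord i \<omega>)) * excess lam (\<alpha> i \<omega>) (p (ord i \<omega>) \<omega>)) \<le> excess_sum k \<omega> + 1"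
proof -
  have "(\<Sum>i=1..k. (1 - h (ord i \<omega>)) * excess lam (\<alpha> i \<omega>) (p (ord i \<omega>) \<omega>))
      \<le> (\<Sum>i=1..k. of_bool (i \<in> later_steps \<and> \<omega> \<in> null_inspected i)
          * excess lam (\<alpha> i \<omega>) (p (ord i \<omega>) \<omega>) + of_bool (i = 1))"
  proof (rule sum_mono)
    fix i assume "i \<in> {1..k}"
    moreover from this have "i \<in> hyp_index m" using hyp_index_mono assms(1) by auto
    ultimately show "(1 - h (ord i \<omega>)) * excess lam (\<alpha> i \<omega>) (p (ord i \<omega>) \<omega>)
        \<le> of_bool (i \<in> later_steps \<and> \<omega> \<in> null_inspected i)
          * excess lam (\<alpha> i \<omega>) (p (ord i \<omega>) \<omega>) + of_bool (i = 1)"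
      using assms(2) excess_le_1[OF alpha_nonneg lam(2)]
      by (auto simp: one_minus_status later_steps_def null_inspected_def)
  qed
  also have "\<dots> = excess_sum k \<omega> + (\<Sum>i=1..k. of_bool (i = 1))"
    unfolding excess_sum_def by (rule sum.distrib)
  also have "(\<Sum>i=1..k. of_bool (i = 1)) = (1::real)"
    using assms(1) by (simp add: hyp_index_def of_bool_def)
  finally show ?thesis .
qed

lemma nu_sum_le_sum_nu:
  assumes "k \<in> hyp_index m" "\<omega> \<in> space M"
  shows "nu_sum k \<omega> \<le> (\<Sum>i=1..k. (1 - h (ord i \<omega>)) * nu lam (\<alpha> i \<omega>))"
  unfolding nu_sum_def
proof (rule sum_mono)
  fix i assume "i \<in> {1..k}"
  then have "i \<in> hyp_index m" using hyp_index_mono assms(1) by auto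
  then have "0 \<le> nu lam (\<alpha> i \<omega>)" using assms(2) alpha_nonneg lam by (simp add: nu_nonneg)
  then show "of_bool (i \<in> later_steps \<and> \<omega> \<in> null_inspected i) * nu lam (\<alpha> i \<omega>)
      \<le> (1 - h (ord i \<omega>)) * nu lam (\<alpha> i \<omega>)"
    by (auto simp: one_minus_status null_inspected_def)
qed

definition false_rejections :: "nat \<Rightarrow> 'a \<Rightarrow> real" where
  "false_rejections k \<omega> = (\<Sum>i=1..k. (1 - h (ord i \<omega>)) * of_bool (p (ord i \<omega>) \<omega> \<le> \<alpha> i \<omega>))"

lemma false_rejections_le_Vbar:
  assumes \<delta>: "0 < \<delta>" "\<delta> < 1" and k: "k \<in> hyp_index m" and \<omega>: "\<omega> \<in> space M"
    and le: "excess_sum k \<omega> + 1 \<le> Delta \<delta> (nu_sum k \<omega>)"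
  shows "false_rejections k \<omega> \<le> Vbar h p ord \<alpha> lam \<delta> k \<omega>"
proof -
  have "(\<Sum>i=1..k. (1 - h (ord i \<omega>)) * excess lam (\<alpha> i \<omega>) (p (ord i \<omega>) \<omega>)) \<le> Delta \<delta> (nu_sum k \<omega>)"
    using sum_excess_le_excess_sum[OF k \<omega>] le by (rule order_trans)
  also have "\<dots> \<le> Delta \<delta> (\<Sum>i=1..k. (1 - h (ord i \<omega>)) * nu lam (\<alpha> i \<omega>))"
    by (rule Delta_mono[OF \<delta> nu_sum_le_sum_nu[OF k \<omega>]])
  finally show ?thesis
    by (simp add: false_rejections_def Vbar_def excess_def right_diff_distrib sum_subtractf
        mult.assoc)
qed

lemma false_rejections_Vbar_measurable:
  assumes "k \<in> hyp_index m"
  shows "false_rejections k \<in> borel_measurable M" "Vbar h p ord \<alpha> lam \<delta> k \<in> borel_measurable M"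
proof -
  have [measurable]: "(\<lambda>\<omega>. p (ord i \<omega>) \<omega>) \<in> borel_measurable M" "\<alpha> i \<in> borel_measurable M"
    "ord i \<in> measurable M (count_space UNIV)" if "i \<in> {1..k}" for i
    using that assms by (auto intro!: inspected_pvalue_measurable alpha_measurable ord_measurable
        intro: hyp_index_mono)
  show "false_rejections k \<in> borel_measurable M" "Vbar h p ord \<alpha> lam \<delta> k \<in> borel_measurable M"
    unfolding false_rejections_def Vbar_def by measurable
qed

lemma prob_false_rejections_le_Vbar:
  assumes \<delta>: "0 < \<delta>" "\<delta> < 1"
  shows "1 - \<delta> \<le> prob {\<omega> \<in> space M. \<forall>k \<in> hyp_index m. false_rejections k \<omega> \<le> Vbar h p ord \<alpha> lam \<delta> k \<omega>}"
    (is "_ \<le> prob ?Good")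
proof -
  let ?Cross = "{\<omega> \<in> space M. \<exists>n. Delta \<delta> (nu_sum n \<omega>) < excess_sum n \<omega> + 1}"
  have [measurable]: "?Cross \<in> events" by measurable
  have "?Good \<in> events"
    using false_rejections_Vbar_measurable by (intro sets.sets_Collect_countable_All') auto
  moreover have "space M - ?Cross \<subseteq> ?Good"
    by (auto simp: not_less intro: false_rejections_le_Vbar[OF \<delta>])
  ultimately have "prob (space M - ?Cross) \<le> prob ?Good" by (rule finite_measure_mono[rotated])
  then show ?thesis
    using prob_Delta_nu_sum_less_excess_sum[OF \<delta>] by (simp add: prob_compl)
qed

end

theorem theorem38:
  fixes M :: "'a measure" and N :: "'x measure" and X :: "'a \<Rightarrow> 'x"
    and m :: enat and H :: "nat \<Rightarrow> 'x measure set"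
    and p :: "nat \<Rightarrow> 'a \<Rightarrow> real" and \<pi> :: "nat \<Rightarrow> 'a \<Rightarrow> nat" and \<alpha> :: "nat \<Rightarrow> 'a \<Rightarrow> real"
    and lam \<delta> :: real
  defines "\<F> \<equiv> pval_filtration M p \<pi> \<alpha> lam"
    and "h \<equiv> null_status (distr M N X) H"
  assumes "prob_space M" and "X \<in> measurable M N"
    and "\<And>i. i \<in> hyp_index m \<Longrightarrow> p i \<in> borel_measurable (vimage_algebra (space M) X N)"
    and "\<And>i \<omega>. i \<in> hyp_index m \<Longrightarrow> \<omega> \<in> space M \<Longrightarrow> p i \<omega> \<in> {0..1}"
    and "\<And>i. i \<in> hyp_index m \<Longrightarrow>
           \<pi> i \<in> measurable (vimage_algebra (space M) X N) (count_space UNIV)"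
    and "\<And>i \<omega>. i \<in> hyp_index m \<Longrightarrow> \<omega> \<in> space M \<Longrightarrow> \<pi> i \<omega> \<in> hyp_index m"
    and "\<And>\<omega>. \<omega> \<in> space M \<Longrightarrow> inj_on (\<lambda>i. \<pi> i \<omega>) (hyp_index m)"
    and "\<And>i. i \<in> hyp_index m \<Longrightarrow> \<alpha> i \<in> borel_measurable (vimage_algebra (space M) X N)"
    and "\<And>i \<omega>. i \<in> hyp_index m \<Longrightarrow> \<omega> \<in> space M \<Longrightarrow> 0 \<le> \<alpha> i \<omega>"
    and "0 \<le> lam" and "lam < 1"
    and "\<And>k. k \<in> hyp_index m \<Longrightarrow> 2 \<le> k \<Longrightarrow> \<alpha> k \<in> borel_measurable (\<F> (k - 1))"
    and "\<And>k t. k \<in> hyp_index m \<Longrightarrow> 2 \<le> k \<Longrightarrow> t \<in> {0..1} \<Longrightarrow>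
           AE \<omega> in M. cond_prob_given M (\<F> (k - 1))
             {\<omega> \<in> space M. h (\<pi> k \<omega>) = 0} {\<omega> \<in> space M. p (\<pi> k \<omega>) \<omega> \<le> t} \<omega> \<le> t"
    and "0 < \<delta>" and "\<delta> < 1"
  shows "\<P>(\<omega> in M. \<forall>k \<in> hyp_index m.
             (\<Sum>i=1..k. (1 - h (\<pi> i \<omega>)) * of_bool (p (\<pi> i \<omega>) \<omega> \<le> \<alpha> i \<omega>))
               \<le> Vbar h p \<pi> \<alpha> lam \<delta> k \<omega>) \<ge> 1 - \<delta>"
proof -
  interpret prob_space M by fact
  have subalg: "subalgebra M (vimage_algebra (space M) X N)"
    using measurable_space[OF assms(4)] assms(4)
    by (auto simp: subalgebra_def sets_vimage_algebra2 Pi_iff)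
  interpret ordered_pvalues M m h p \<pi> \<alpha> lam
  proof
    fix i assume i: "i \<in> hyp_index m"
    show "p i \<in> borel_measurable M" "\<pi> i \<in> measurable M (count_space UNIV)" "\<alpha> i \<in> borel_measurable M"
      using assms(5,7,10)[OF i] by (auto intro: measurable_from_subalg[OF subalg])
    show "p i \<omega> \<le> 1" "\<pi> i \<omega> \<in> hyp_index m" "0 \<le> \<alpha> i \<omega>" if "\<omega> \<in> space M" for \<omega>
      using assms(6,8,11)[OF i that] by auto
  qed (use assms(12-15) in \<open>auto simp: h_def \<F>_def null_status_def\<close>)
  show ?thesis
    using prob_false_rejections_le_Vbar[OF assms(16,17)] by (simp add: false_rejections_def)
qed

end
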